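(* Let $\Xi=(\theta,\{\eta_e\}_{e=1}^{E},\{\zeta_e\}_{e=1}^{E},\{\pi_e\}_{e=1}^{E})$ and $\Xi'=(\theta',\{\eta'_e\}_{e=1}^{E},\{\zeta'_e\}_{e=1}^{E},\{\pi'_e\}_{e=1}^{E})$ be two parameter collections of the observation model described in the context (so, under either one, the functions $r$ take values in $[0,1]$, the $m$'s are real-valued, the $\tau$'s are strictly positive, and the corruption probabilities lie in $[0,1)$). Assume: (i) (Centering on observable support) For each expert $e$ with nonzero observation probability, $$\mathbb{E}_{(a,b)\mid e}[m_{\eta_e}(\phi_{ab})]=0\quad\text{and}\quad \mathbb{E}_{(a,b)\mid e}[m_{\eta'_e}(\phi_{ab})]=0,$$ where the expectation is over the observable-pair distribution conditional on expert $e$. (ii) (Structural separability) If for all observable triples $(a,b,e)$ $$\operatorname{logit}_{\varepsilon}\big(r_{\theta}(x_a,x_b)\big)+m_{\eta_e}(\phi_{ab})=\operatorname{logit}_{\varepsilon}\big(r_{\theta'}(x_a,x_b)\big)+m_{\eta'_e}(\phi_{ab}),$$ then for each expert $e$ there exists a constant $k_e\in\mathbb{R}$ such that for all observable triples $(a,b,e)$ with that $e$, $$\operatorname{logit}_{\varepsilon}\big(r_{\theta}(x_a,x_b)\big)=\operatorname{logit}_{\varepsilon}\big(r_{\theta'}(x_a,x_b)\big)+k_e\quad\text{and}\quad m_{\eta_e}(\phi_{ab})=m_{\eta'_e}(\phi_{ab})-k_e.$$ (iii) $r_{\theta}(x_a,x_b)\in[\varepsilon,1-\varepsilon]$ and $r_{\theta'}(x_a,x_b)\in[\varepsilon,1-\varepsilon]$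 for all $(a,b)\in\mathcal{P}_{\mathrm{obs}}$. (iv) For every observable triple $(a,b,e)$, the conditional laws of the observed response induced by $\Xi$ and by $\Xi'$ coincide, i.e. $p_{\Xi}(y\mid a,b,e)=p_{\Xi'}(y\mid a,b,e)$ for all $y\in(0,1)$. Then $r_{\theta}(x_a,x_b)=r_{\theta'}(x_a,x_b)$ for all $(a,b)\in\mathcal{P}_{\mathrm{obs}}$. (That is, the aleatoric relation $R^\star_{ab}=r_\theta(x_a,x_b)$ is identifiable on observable pairs.)
   Context: Let $\mathcal{X}=\{x_j\}_{j=1}^{|\mathcal{X}|}$ be a finite dataset and let $e\in\{1,\dots,E\}$ index experts. Each index pair $(a,b)$ has a deterministic descriptor $\phi_{ab}=\phi(x_a,x_b)$ for a fixed function $\phi$. Observability: there is a fixed probability distribution on triples $(a,b,e)$ (pair and expert); a triple is observable if it has positive probability. An expert $e$ has nonzero observation probability if its marginal probability is positive, and for such $e$, $\mathbb{E}_{(a,b)\mid e}$ denotes expectation under the conditional distribution of $(a,b)$ given $e$ (the observable-pair distribution conditional on $e$). The support of observable pairs is $\mathcal{P}_{\mathrm{obs}}:=\{(a,b):\exists e\text{ such that }(a,b,e)\text{ is observable}\}$. Clamped logit: fix a small $\varepsilon\in(0,1/2)$. With $\operatorname{logit}(u)=\log(u/(1-u))$ for $u\in(0,1)$, set $\operatorname{logit}_{\varepsilon}(u):=\operatorname{logit}(\min\{\max\{u,\varepsilon\},1-\varepsilon\})$ for $u\in[0,1]$. Parametric families: a parameter collection $\Xi=(\theta,\{\eta_e\},\{\zeta_e\},\{\pi_e\})$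 determines a relation function $r_\theta(x_a,x_b)\in[0,1]$ (the aleatoric relation $R^\star_{ab}$), expert mean effects $m_{\eta_e}(\phi_{ab})\in\mathbb{R}$, expert scales $\tau_{\zeta_e}(\phi_{ab})>0$, and corruption probabilities $\pi_e\in[0,1)$. No further structure on these parametric families is assumed. Observation law: under $\Xi$, the observed response $y$ for a triple $(a,b,e)$ has conditional density on $(0,1)$ $$p_{\Xi}(y\mid a,b,e)=(1-\pi_e)\,\frac{1}{y(1-y)}\,\varphi\Big(\operatorname{logit}(y);\ \operatorname{logit}_{\varepsilon}(r_\theta(x_a,x_b))+m_{\eta_e}(\phi_{ab}),\ \tau_{\zeta_e}^2(\phi_{ab})\Big)+\pi_e,$$ where $\varphi(\cdot;\mu,s^2)$ is the density of the Gaussian $\mathcal{N}(\mu,s^2)$; this is a mixture of a logistic-normal law with weight $1-\pi_e$ and the uniform law on $(0,1)$ with weight $\pi_e$. $p_{\Xi'}$ is defined in the same way from $\Xi'$. *)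

theory Defs
  imports "HOL-Probability.Probability"
begin

definition logit :: "real \<Rightarrow> real" where
  "logit u = ln (u / (1 - u))"

definition clamped_logit :: "real \<Rightarrow> real \<Rightarrow> real" where
  "clamped_logit \<epsilon> u = logit (min (max u \<epsilon>) (1 - \<epsilon>))"

text \<open>
  Pairs are pairs of dataset indices, and a triple \<open>(a, b, e)\<close> consists of such a pair and an expert.
\<close>

definition observable :: "(nat \<times> nat \<times> nat) pmf \<Rightarrow> nat \<Rightarrow> nat \<Rightarrow> nat \<Rightarrow> bool" where
  "observable D a b e \<longleftrightarrow> pmf D (a, b, e) > 0"

definition observable_pairs :: "(nat \<times> nat \<times> nat) pmf \<Rightarrow> (nat \<times> nat) set" where
  "observable_pairs D = {(a, b). \<exists>e. observable D a b e}"

definition expert_prob :: "(nat \<times> nat \<times> nat) pmf \<Rightarrow> nat \<Rightarrow> real" where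
  "expert_prob D e = measure_pmf.prob D {(a, b, e'). e' = e}"

text \<open>Conditional law of the pair given the expert; only meaningful if \<open>expert_prob D e > 0\<close>.\<close>

definition pair_given_expert :: "(nat \<times> nat \<times> nat) pmf \<Rightarrow> nat \<Rightarrow> (nat \<times> nat) pmf" where
  "pair_given_expert D e = map_pmf (\<lambda>(a, b, e'). (a, b)) (cond_pmf D {(a, b, e'). e' = e})"

record ('t, 'h, 'z) param_collection =
  theta :: 't
  eta :: "nat \<Rightarrow> 'h"
  zeta :: "nat \<Rightarrow> 'z"
  corruption :: "nat \<Rightarrow> real"

text \<open>
  \<open>x\<close> enumerates the \<open>N\<close> data points, \<open>E\<close> is the number of experts, and \<open>r\<close>, \<open>\<tau>\<close> are the
  parametric families of relation functions and expert scales.  The range conditions are imposed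
  only on the dataset and on the parameters that occur in \<open>\<Xi>\<close>.
\<close>

definition admissible ::
  "nat \<Rightarrow> nat \<Rightarrow> (nat \<Rightarrow> 'x) \<Rightarrow> ('x \<Rightarrow> 'x \<Rightarrow> 'd) \<Rightarrow> ('t \<Rightarrow> 'x \<Rightarrow> 'x \<Rightarrow> real) \<Rightarrow> ('z \<Rightarrow> 'd \<Rightarrow> real) \<Rightarrow>
   ('t, 'h, 'z) param_collection \<Rightarrow> bool"
where
  "admissible N E x \<phi> r \<tau> \<Xi> \<longleftrightarrow>
     (\<forall>a\<in>{1..N}. \<forall>b\<in>{1..N}. r (theta \<Xi>) (x a) (x b) \<in> {0..1}) \<and>
     (\<forall>a\<in>{1..N}. \<forall>b\<in>{1..N}. \<forall>e\<in>{1..E}. \<tau> (zeta \<Xi> e) (\<phi> (x a) (x b)) > 0) \<and>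
     (\<forall>e\<in>{1..E}. corruption \<Xi> e \<in> {0..<1})"

text \<open>
  The density at \<open>y \<in> (0, 1)\<close> of the response to \<open>(a, b, e)\<close>.  The second argument of
  \<^const>\<open>normal_density\<close> is the standard deviation, so the Gaussian has variance \<open>\<tau>\<^sup>2\<close>.
\<close>

definition response_density ::
  "real \<Rightarrow> (nat \<Rightarrow> 'x) \<Rightarrow> ('x \<Rightarrow> 'x \<Rightarrow> 'd) \<Rightarrow> ('t \<Rightarrow> 'x \<Rightarrow> 'x \<Rightarrow> real) \<Rightarrow> ('h \<Rightarrow> 'd \<Rightarrow> real) \<Rightarrow>
   ('z \<Rightarrow> 'd \<Rightarrow> real) \<Rightarrow> ('t, 'h, 'z) param_collection \<Rightarrow> nat \<Rightarrow> nat \<Rightarrow> nat \<Rightarrow> real \<Rightarrow> real"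
where
  "response_density \<epsilon> x \<phi> r m \<tau> \<Xi> a b e y =
     (1 - corruption \<Xi> e) * (1 / (y * (1 - y))) *
       normal_density
         (clamped_logit \<epsilon> (r (theta \<Xi>) (x a) (x b)) + m (eta \<Xi> e) (\<phi> (x a) (x b)))
         (\<tau> (zeta \<Xi> e) (\<phi> (x a) (x b)))
         (logit y)
     + corruption \<Xi> e"

end

theory Submission
  imports Defs "HOL-Real_Asymp.Real_Asymp"
begin

text \<open>
  The Gaussian part of the response density decays faster than the Jacobian $1/(y(1-y))$ of the
  logit grows, so the density tends to the corruption probability as $y \to 1$.  Equal laws
  therefore have equal corruption probabilities, hence equal Gaussian parts, hence equal Gaussian
  means.  Separability then says that on each expert's observable pairs the two mean effects differ
  by a constant; the centering makes this constant zero, and the logit is injective.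
\<close>

lemma inj_on_logit: "inj_on logit {0<..<1}"
proof (rule inj_onI)
  fix u v :: real
  assume uv: "u \<in> {0<..<1}" "v \<in> {0<..<1}" "logit u = logit v"
  then have "u / (1 - u) = v / (1 - v)"
    by (simp add: logit_def)
  with uv show "u = v"
    by (simp add: field_simps)
qed

lemma clamped_logit_eq_logit: "u \<in> {\<epsilon>..1 - \<epsilon>} \<Longrightarrow> clamped_logit \<epsilon> u = logit u"
  by (simp add: clamped_logit_def)

text \<open>The inverse of \<open>logit\<close>. Substituting \<open>y = logistic z\<close> turns an
  identity of densities on (0,1) into one on the whole line, where the limit y \<rightarrow> 1
  becomes z \<rightarrow> \<infinity>.\<close>

definition logistic :: "real \<Rightarrow> real" where
  "logistic z = 1 / (1 + exp (- z))"

lemma logistic_in_01: "logistic z \<in> {0<..<1}"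
  by (simp add: logistic_def field_simps add_pos_pos)

lemma logit_logistic: "logit (logistic z) = z"
proof -
  have "1 + exp (- z) > 0"
    by (simp add: add_pos_pos)
  then have "logistic z / (1 - logistic z) = exp z"
    by (simp add: logistic_def field_simps exp_minus)
  then show ?thesis
    by (simp add: logit_def)
qed

text \<open>Written in exponentials, the Jacobian visibly grows like \<open>exp z\<close> at
  infinity.\<close>

lemma logistic_jacobian: "1 / (logistic z * (1 - logistic z)) = (1 + exp (- z))\<^sup>2 * exp z"
proof -
  have "1 + exp (- z) > 0"
    by (simp add: add_pos_pos)
  then have "1 - logistic z = exp (- z) / (1 + exp (- z))"
    by (simp add: logistic_def field_simps)
  then have "1 / (logistic z * (1 - logistic z)) = (1 + exp (- z))\<^sup>2 * (1 / exp (- z))"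
    by (simp add: logistic_def power2_eq_square)
  then show ?thesis
    by (simp add: exp_minus divide_inverse)
qed

lemma logit_normal_density_tendsto_0:
  assumes "s > 0"
  shows "((\<lambda>z. (1 + exp (- z))\<^sup>2 * exp z * normal_density \<mu> s z) \<longlongrightarrow> 0) at_top"
  unfolding normal_density_def using assms by real_asymp

text \<open>A normal density attains its peak value exactly at its mean. Evaluating at both means
  shows that neither peak is higher than the other, so the second density reaches its own peak at
  \<open>\<mu>\<close>, which must then be \<open>\<mu>'\<close>. The standard deviations never have
  to be compared.\<close>

lemma normal_density_mean_eq:
  assumes pos: "s > 0" "s' > 0"
    and eq: "\<And>z. normal_density \<mu> s z = normal_density \<mu>' s' z"
  shows "\<mu> = \<mu>'"
proof -
  define h where "h s = 1 / sqrt (2 * pi * s\<^sup>2)" for s :: real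
  have h: "h s > 0" if "s > 0" for s
    using that by (simp add: h_def)
  have nd: "normal_density \<mu> s z = h s * exp (- (z - \<mu>)\<^sup>2 / (2 * s\<^sup>2))" for \<mu> s z
    by (simp add: normal_density_def h_def)
  have le: "normal_density \<mu> s z \<le> h s" if "s > 0" for \<mu> s z
    using h[OF that] by (simp add: nd mult_le_cancel_left2)
  have "h s = normal_density \<mu>' s' \<mu>" "h s' = normal_density \<mu> s \<mu>'"
    using nd[of \<mu> s \<mu>] nd[of \<mu>' s' \<mu>'] eq by simp_all
  \<comment> \<open>The two bounds read \<open>h s \<le> h s'\<close> and
    \<open>h s' \<le> h s\<close>.\<close>
  with le[OF pos(2), of \<mu>' \<mu>] le[OF pos(1), of \<mu> \<mu>']
  have "normal_density \<mu>' s' \<mu> = h s'"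
    by linarith
  with h[OF pos(2)] have "(\<mu> - \<mu>')\<^sup>2 / (2 * s'\<^sup>2) = 0"
    by (simp add: nd)
  with pos show ?thesis
    by simp
qed

text \<open>The bound \<open>p < 1\<close> matters: at \<open>p = 1\<close> the Gaussian part
  vanishes and its mean leaves no trace in the density.\<close>

lemma contaminated_logit_normal_mean_eq:
  fixes \<mu> \<mu>' s s' p p' :: real
  assumes pos: "s > 0" "s' > 0" and p: "p < 1"
    and eq: "\<And>y. y \<in> {0<..<1} \<Longrightarrow>
      (1 - p) * (1 / (y * (1 - y))) * normal_density \<mu> s (logit y) + p =
      (1 - p') * (1 / (y * (1 - y))) * normal_density \<mu>' s' (logit y) + p'"
  shows "\<mu> = \<mu>'"
proof -
  define J where "J z = (1 + exp (- z))\<^sup>2 * exp z" for z :: real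
  have J: "J z > 0" for z
    unfolding J_def by (intro mult_pos_pos zero_less_power add_pos_pos) simp_all
  have eqJ: "(1 - p) * (J z * normal_density \<mu> s z) + p =
      (1 - p') * (J z * normal_density \<mu>' s' z) + p'" for z
    using eq[OF logistic_in_01, of z]
    by (simp only: logistic_jacobian logit_logistic J_def mult.assoc)
  have lim: "((\<lambda>z. (1 - q) * (J z * normal_density \<nu> t z) + q) \<longlongrightarrow> q) at_top"
    if "t > 0" for q \<nu> t :: real
    unfolding J_def by (rule tendsto_eq_intros logit_normal_density_tendsto_0 that refl | simp)+
  \<comment> \<open>Folding with \<open>eqJ\<close> rewrites the primed function into the unprimed
    one, so a single function has both limits \<open>p\<close> and \<open>p'\<close>.\<close>
  have "p = p'"
    using tendsto_unique[OF _ lim[OF pos(1), of p \<mu>] lim[OF pos(2), of p' \<mu>', folded eqJ]]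
    by simp
  \<comment> \<open>The common factor \<open>(1 - p) * J z\<close> is positive and cancels.\<close>
  then have "normal_density \<mu> s z = normal_density \<mu>' s' z" for z
    using eqJ[of z] p J[of z] by simp
  with pos show ?thesis
    by (rule normal_density_mean_eq)
qed

text \<open>Finite support makes \<open>g\<close> integrable, so the constant can be pulled out of
  the expectation.\<close>

lemma measure_pmf_expectation_const_diff:
  fixes f g :: "'a \<Rightarrow> real"
  assumes "finite (set_pmf p)" "\<And>w. w \<in> set_pmf p \<Longrightarrow> f w = g w - k"
  shows "measure_pmf.expectation p f = measure_pmf.expectation p g - k"
proof -
  have "measure_pmf.expectation p f = measure_pmf.expectation p (\<lambda>w. g w - k)"
    using assms(2) by (intro integral_cong_AE) (simp_all add: AE_measure_pmf_iff)
  also have "\<dots> = measure_pmf.expectation p g - k"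
    using assms(1) by (simp add: integrable_measure_pmf_finite)
  finally show ?thesis .
qed

lemma expert_prob_pos:
  assumes "observable D a b e"
  shows "expert_prob D e > 0"
proof -
  have "(a, b, e) \<in> set_pmf D \<inter> {(a, b, e'). e' = e}"
    using assms by (simp add: observable_def set_pmf_iff)
  then show ?thesis
    unfolding expert_prob_def by (intro measure_pmf_posI[of "(a, b, e)"]) auto
qed

text \<open>\<open>cond_pmf\<close> is characterized only when the conditioning event meets the
  support of \<open>D\<close>; positive expert probability ensures this.\<close>

lemma set_pair_given_expert:
  assumes "expert_prob D e > 0"
  shows "set_pmf (pair_given_expert D e) = {(a, b). observable D a b e}"
proof -
  have "set_pmf D \<inter> {(a, b, e'). e' = e} \<noteq> {}"
    using assms unfolding expert_prob_def by (simp add: measure_pmf_zero_iff[symmetric])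
  then show ?thesis
    by (force simp: pair_given_expert_def set_cond_pmf observable_def pmf_positive_iff)
qed

theorem theorem3p5:
  fixes X :: "'x set" and x :: "nat \<Rightarrow> 'x" and E :: nat
    and \<phi> :: "'x \<Rightarrow> 'x \<Rightarrow> 'd"
    and D :: "(nat \<times> nat \<times> nat) pmf"
    and \<epsilon> :: real
    and r :: "'t \<Rightarrow> 'x \<Rightarrow> 'x \<Rightarrow> real"
    and m :: "'h \<Rightarrow> 'd \<Rightarrow> real"
    and \<tau> :: "'z \<Rightarrow> 'd \<Rightarrow> real"
    and \<Xi> \<Xi>' :: "('t, 'h, 'z) param_collection"
  assumes dataset: "finite X" "bij_betw x {1..card X} X"
    and triples: "set_pmf D \<subseteq> {1..card X} \<times> {1..card X} \<times> {1..E}"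
    and eps: "0 < \<epsilon>" "\<epsilon> < 1 / 2"
    and params: "admissible (card X) E x \<phi> r \<tau> \<Xi>" "admissible (card X) E x \<phi> r \<tau> \<Xi>'"
    and centering: "\<And>e. e \<in> {1..E} \<Longrightarrow> expert_prob D e > 0 \<Longrightarrow>
      measure_pmf.expectation (pair_given_expert D e) (\<lambda>(a, b). m (eta \<Xi> e) (\<phi> (x a) (x b))) = 0 \<and>
      measure_pmf.expectation (pair_given_expert D e) (\<lambda>(a, b). m (eta \<Xi>' e) (\<phi> (x a) (x b))) = 0"
    and separability:
      "(\<forall>a b e. observable D a b e \<longrightarrow>
          clamped_logit \<epsilon> (r (theta \<Xi>) (x a) (x b)) + m (eta \<Xi> e) (\<phi> (x a) (x b)) =
          clamped_logit \<epsilon> (r (theta \<Xi>') (x a) (x b)) + m (eta \<Xi>' e) (\<phi> (x a) (x b))) \<Longrightarrow>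
       (\<forall>e\<in>{1..E}. \<exists>k::real. \<forall>a b. observable D a b e \<longrightarrow>
          clamped_logit \<epsilon> (r (theta \<Xi>) (x a) (x b)) =
            clamped_logit \<epsilon> (r (theta \<Xi>') (x a) (x b)) + k \<and>
          m (eta \<Xi> e) (\<phi> (x a) (x b)) = m (eta \<Xi>' e) (\<phi> (x a) (x b)) - k)"
    and unclamped: "\<And>a b. (a, b) \<in> observable_pairs D \<Longrightarrow>
      r (theta \<Xi>) (x a) (x b) \<in> {\<epsilon>..1 - \<epsilon>} \<and> r (theta \<Xi>') (x a) (x b) \<in> {\<epsilon>..1 - \<epsilon>}"
    and same_law: "\<And>a b e y. observable D a b e \<Longrightarrow> y \<in> {0<..<1} \<Longrightarrow>
      response_density \<epsilon> x \<phi> r m \<tau> \<Xi> a b e y = response_density \<epsilon> x \<phi> r m \<tau> \<Xi>' a b e y"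
  shows "\<forall>(a, b) \<in> observable_pairs D. r (theta \<Xi>) (x a) (x b) = r (theta \<Xi>') (x a) (x b)"
proof -
  let ?l = "\<lambda>a b. clamped_logit \<epsilon> (r (theta \<Xi>) (x a) (x b))"
  let ?l' = "\<lambda>a b. clamped_logit \<epsilon> (r (theta \<Xi>') (x a) (x b))"
  let ?m = "\<lambda>e (a, b). m (eta \<Xi> e) (\<phi> (x a) (x b))"
  let ?m' = "\<lambda>e (a, b). m (eta \<Xi>' e) (\<phi> (x a) (x b))"
  have range: "a \<in> {1..card X}" "b \<in> {1..card X}" "e \<in> {1..E}" if "observable D a b e" for a b e
    using that triples by (auto simp: observable_def pmf_positive_iff)
  \<comment> \<open>For a fixed observable triple, both sides are the Gaussian means of the logit
    response, and equal laws force equal means.\<close>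
  have "?l a b + ?m e (a, b) = ?l' a b + ?m' e (a, b)" if obs: "observable D a b e" for a b e
    using contaminated_logit_normal_mean_eq[OF _ _ _
        same_law[OF obs, unfolded response_density_def]] params range[OF obs]
    by (simp add: admissible_def)
  then have "\<forall>e\<in>{1..E}. \<exists>k. \<forall>a b. observable D a b e \<longrightarrow>
      ?l a b = ?l' a b + k \<and> ?m e (a, b) = ?m' e (a, b) - k"
    using separability by simp
  from bchoice[OF this] obtain k where k: "\<And>a b e. observable D a b e \<Longrightarrow>
      ?l a b = ?l' a b + k e \<and> ?m e (a, b) = ?m' e (a, b) - k e"
    using range(3) by blast
  show ?thesis
  proof clarify
    fix a b
    assume ab: "(a, b) \<in> observable_pairs D"
    then obtain e where obs: "observable D a b e"
      by (auto simp: observable_pairs_def)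
    let ?p = "pair_given_expert D e"
    have pos: "expert_prob D e > 0"
      using obs by (rule expert_prob_pos)
    have "set_pmf ?p \<subseteq> {1..card X} \<times> {1..card X}"
      using range by (auto simp: set_pair_given_expert[OF pos])
    then have "finite (set_pmf ?p)"
      by (rule finite_subset) simp
    then have "measure_pmf.expectation ?p (?m e) = measure_pmf.expectation ?p (?m' e) - k e"
      using k by (intro measure_pmf_expectation_const_diff)
        (auto simp: set_pair_given_expert[OF pos])
    \<comment> \<open>Both expectations vanish, and they differ by \<open>k e\<close>.\<close>
    with centering[OF range(3)[OF obs] pos] have "k e = 0"
      by simp
    \<comment> \<open>On [\<epsilon>, 1 - \<epsilon>] the clamp is inactive, and
      \<open>\<epsilon> > 0\<close> keeps this interval inside (0,1), where \<open>logit\<close> is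
      injective.\<close>
    with k[OF obs] unclamped[OF ab]
    have "logit (r (theta \<Xi>) (x a) (x b)) = logit (r (theta \<Xi>') (x a) (x b))"
      by (simp add: clamped_logit_eq_logit)
    moreover have "r (theta \<Xi>) (x a) (x b) \<in> {0<..<1}" "r (theta \<Xi>') (x a) (x b) \<in> {0<..<1}"
      using unclamped[OF ab] eps by auto
    ultimately show "r (theta \<Xi>) (x a) (x b) = r (theta \<Xi>') (x a) (x b)"
      by (rule inj_onD[OF inj_on_logit])
  qed
qed

end
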